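(* For each \(m\in\{3,5\}\) there exist functions \(d_t:A_{7,m}\times\mathbb Z_7\to\mathbb Z_7\), \(t\in\mathbb Z_m\), such that: (1) for every \(t\in\mathbb Z_m\) and \(w\in A_{7,m}\), the map \(\kappa\mapsto d_t(w,\kappa)\) is a permutation of \(\mathbb Z_7\); (2) for every \(t\in\mathbb Z_m\) and \(\kappa\in\mathbb Z_7\), the map \(P_{t,\kappa}(w)=w+q_{d_t(w,\kappa)}\) is a bijection of \(A_{7,m}\); (3) for every \(\kappa\in\mathbb Z_7\), the composition \(P_{m-1,\kappa}\circ\cdots\circ P_{0,\kappa}\) is a single cycle on \(A_{7,m}\), of length \(m^6\).
   Context: \(A_{7,m}=\{w=(w_0,\ldots,w_6)\in(\mathbb Z_m)^7:\sum_i w_i=0\}\); \(e_0,\ldots,e_6\) are the standard basis vectors of \((\mathbb Z_m)^7\); \(q_i=e_i-e_6\) for \(0\le i\le5\) and \(q_6=0\). Such a family is called a valid \((7,m)\)-root-flat certificate. *)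

theory Defs
  imports "HOL-Library.FuncSet" "HOL-Combinatorics.Orbits"
begin

text \<open>
  \<open>\<int>\<^sub>m\<close> is represented by the residues \<open>{0..<int m}\<close> and \<open>\<int>\<^sub>7\<close>, which only
  serves as an index set, by \<open>{..<7}\<close>. Vectors are extensional functions
  (\<open>undefined\<close> outside \<open>{..<7}\<close>), so that HOL equality is equality of vectors.
\<close>

definition Zvec :: "nat \<Rightarrow> (nat \<Rightarrow> int) set" where
  "Zvec m = {..<7} \<rightarrow>\<^sub>E {0..<int m}"

definition vadd :: "nat \<Rightarrow> (nat \<Rightarrow> int) \<Rightarrow> (nat \<Rightarrow> int) \<Rightarrow> nat \<Rightarrow> int" where
  "vadd m v w = (\<lambda>j\<in>{..<7}. (v j + w j) mod int m)"

definition vdiff :: "nat \<Rightarrow> (nat \<Rightarrow> int) \<Rightarrow> (nat \<Rightarrow> int) \<Rightarrow> nat \<Rightarrow> int" where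
  "vdiff m v w = (\<lambda>j\<in>{..<7}. (v j - w j) mod int m)"

definition vzero :: "nat \<Rightarrow> int" where
  "vzero = (\<lambda>j\<in>{..<7}. 0)"

definition unit_vec :: "nat \<Rightarrow> nat \<Rightarrow> int" where
  "unit_vec i = (\<lambda>j\<in>{..<7}. if j = i then 1 else 0)"

definition A7 :: "nat \<Rightarrow> (nat \<Rightarrow> int) set" where
  "A7 m = {w \<in> Zvec m. (\<Sum>i<7. w i) mod int m = 0}"

definition qvec :: "nat \<Rightarrow> nat \<Rightarrow> nat \<Rightarrow> int" where
  "qvec m i = (if i = 6 then vzero else vdiff m (unit_vec i) (unit_vec 6))"

definition Pmap :: "nat \<Rightarrow> (nat \<Rightarrow> (nat \<Rightarrow> int) \<Rightarrow> nat \<Rightarrow> nat) \<Rightarrow> nat \<Rightarrow> nat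
    \<Rightarrow> (nat \<Rightarrow> int) \<Rightarrow> (nat \<Rightarrow> int)" where
  "Pmap m d t \<kappa> w = vadd m w (qvec m (d t w \<kappa>))"

text \<open>
  \<open>fold\<close> applies \<open>t = 0\<close> first, so this is \<open>P\<^sub>m\<^sub>-\<^sub>1 \<circ> \<dots> \<circ> P\<^sub>0\<close>.
\<close>

definition Pcomp :: "nat \<Rightarrow> (nat \<Rightarrow> (nat \<Rightarrow> int) \<Rightarrow> nat \<Rightarrow> nat) \<Rightarrow> nat
    \<Rightarrow> (nat \<Rightarrow> int) \<Rightarrow> (nat \<Rightarrow> int)" where
  "Pcomp m d \<kappa> = fold (\<lambda>t. Pmap m d t \<kappa>) [0..<m]"

text \<open>
  \<open>cyclic_on f A\<close> says that \<open>A\<close> is a single (finite) orbit of \<open>f\<close>; the length of the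
  cycle is then \<open>card A\<close>.
\<close>

definition valid_root_flat_certificate ::
    "nat \<Rightarrow> (nat \<Rightarrow> (nat \<Rightarrow> int) \<Rightarrow> nat \<Rightarrow> nat) \<Rightarrow> bool" where
  "valid_root_flat_certificate m d \<longleftrightarrow>
     (\<forall>t<m. \<forall>w\<in>A7 m. bij_betw (\<lambda>\<kappa>. d t w \<kappa>) {..<7} {..<7}) \<and>
     (\<forall>t<m. \<forall>\<kappa><7. bij_betw (Pmap m d t \<kappa>) (A7 m) (A7 m)) \<and>
     (\<forall>\<kappa><7. cyclic_on (Pcomp m d \<kappa>) (A7 m) \<and> card (A7 m) = m ^ 6)"

end

theory Submission
  imports Defs "HOL-Number_Theory.Cong"
begin

text \<open>
  In suitable coordinates of \<open>A\<^sub>7\<^sub>,\<^sub>m\<close>, given by the sums of \<open>w\<close> over the blocks of a binary tree of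
  directions, every map \<open>P\<^sub>t\<^sub>,\<^sub>\<kappa>\<close> is triangular: the increment of each coordinate is a function of the
  previous ones. The composition of such maps is an iterated skew product over \<open>\<int>\<^sub>m\<close>, and it is a
  single cycle as soon as, for each coordinate, the increments summed over all layers and all
  values of the previous coordinates have a total coprime to \<open>m\<close>. Directions that do not
  depend on the previous coordinate contribute a multiple of \<open>m\<close>, so that a few transpositions
  of two directions at isolated points, in the layers \<open>t < 3\<close>, suffice to adjust these totals
  to \<open>\<plusminus>1\<close> or \<open>\<plusminus>2\<close>.
\<close>

subsection \<open>Compositions of triangular maps\<close>

definition box :: "nat \<Rightarrow> nat \<Rightarrow> int list set" where
  "box m n = {xs. set xs \<subseteq> {0..<int m} \<and> length xs = n}"

fun tri :: "nat \<Rightarrow> (int list \<Rightarrow> int) \<Rightarrow> int list \<Rightarrow> int list" where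
  "tri m f [] = []"
| "tri m f (a # xs) = ((a + f xs) mod int m) # tri m f xs"

abbreviation tris :: "nat \<Rightarrow> (nat \<Rightarrow> int list \<Rightarrow> int) \<Rightarrow> nat \<Rightarrow> int list \<Rightarrow> int list" where
  "tris m f n \<equiv> fold (\<lambda>t. tri m (f t)) [0..<n]"

lemma finite_box: "finite (box m n)"
  unfolding box_def by (simp add: finite_lists_length_eq)

lemma card_box: "card (box m n) = m ^ n"
  unfolding box_def by (simp add: card_lists_length_eq)

lemma box_0: "box m 0 = {[]}"
  by (auto simp: box_def)

lemma Cons_in_box_iff: "a # xs \<in> box m (Suc n) \<longleftrightarrow> 0 \<le> a \<and> a < int m \<and> xs \<in> box m n"
  by (auto simp: box_def)

lemma in_box_Suc_conv: "ys \<in> box m (Suc n) \<longleftrightarrow>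
    (\<exists>a xs. ys = a # xs \<and> 0 \<le> a \<and> a < int m \<and> xs \<in> box m n)"
  by (cases ys) (auto simp: box_def)

lemma sum_box_Suc: "(\<Sum>ys\<in>box m (Suc n). h ys) = (\<Sum>xs\<in>box m n. \<Sum>a\<in>{0..<int m}. h (a # xs))"
proof -
  have "(\<Sum>ys\<in>box m (Suc n). h ys) = (\<Sum>(xs, a)\<in>box m n \<times> {0..<int m}. h (a # xs))"
    by (rule sum.reindex_bij_witness[where j = "\<lambda>ys. (tl ys, hd ys)" and i = "\<lambda>(xs, a). a # xs"])
      (auto simp: in_box_Suc_conv)
  then show ?thesis
    by (simp add: sum.cartesian_product)
qed

lemma mod_add_inj:
  assumes "0 \<le> a" "a < int m" "0 \<le> b" "b < int m" "(a + c) mod int m = (b + c) mod int m"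
  shows "a = b"
proof -
  have "a mod int m = b mod int m"
    using assms(5) by (metis add_diff_cancel_right' mod_diff_left_eq)
  then show ?thesis
    using assms by simp
qed

lemma tri_in_box: "xs \<in> box m n \<Longrightarrow> tri m f xs \<in> box m n"
proof (induction n arbitrary: xs)
  case 0
  then show ?case by (simp add: box_0)
next
  case (Suc n)
  then show ?case by (auto simp: in_box_Suc_conv)
qed

lemma inj_on_tri: "inj_on (tri m f) (box m n)"
proof (induction n)
  case 0
  then show ?case by (simp add: box_0)
next
  case (Suc n)
  show ?case
  proof (rule inj_onI)
    fix xs ys assume xs: "xs \<in> box m (Suc n)" and ys: "ys \<in> box m (Suc n)"
      and eq: "tri m f xs = tri m f ys"
    obtain a xs' where a: "xs = a # xs'" "0 \<le> a" "a < int m" "xs' \<in> box m n"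
      using xs by (auto simp: in_box_Suc_conv)
    obtain b ys' where b: "ys = b # ys'" "0 \<le> b" "b < int m" "ys' \<in> box m n"
      using ys by (auto simp: in_box_Suc_conv)
    have "xs' = ys'"
      using eq a b Suc.IH by (auto dest: inj_onD)
    then show "xs = ys"
      using eq a b mod_add_inj[of a m b "f ys'"] by simp
  qed
qed

lemma bij_betw_tri: "bij_betw (tri m f) (box m n) (box m n)"
  unfolding bij_betw_def
  by (intro conjI inj_on_tri endo_inj_surj finite_box) (auto simp: tri_in_box)

lemma bij_betw_tris: "bij_betw (tris m f k) (box m n) (box m n)"
proof (induction k)
  case 0
  then show ?case by (simp add: bij_betw_def)
next
  case (Suc k)
  then show ?case
    using bij_betw_trans[OF Suc.IH bij_betw_tri] by (simp add: comp_def)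
qed

lemma tris_Nil: "tris m f k [] = []"
  by (induction k) auto

text \<open>The tail evolves without reading the head, so the head just collects the increments met
  along the tail's path: a skew product.\<close>

lemma tris_Cons:
  assumes "0 \<le> a" "a < int m"
  shows "tris m f k (a # xs) = ((a + (\<Sum>t<k. f t (tris m f t xs))) mod int m) # tris m f k xs"
  using assms by (induction k) (simp_all add: mod_add_left_eq add.assoc)

lemma funpow_skew:
  assumes "\<And>a x. 0 \<le> a \<Longrightarrow> a < int m \<Longrightarrow> x \<in> X \<Longrightarrow> H (a # x) = ((a + c x) mod int m) # G x"
    and "\<And>x. x \<in> X \<Longrightarrow> G x \<in> X" and "x \<in> X" "0 \<le> a" "a < int m"
  shows "(H ^^ n) (a # x) = ((a + (\<Sum>j<n. c ((G ^^ j) x))) mod int m) # (G ^^ n) x"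
proof -
  have "(G ^^ n) x \<in> X" for n
    using assms by (induction n) auto
  then show ?thesis
    using assms by (induction n) (simp_all add: mod_add_left_eq add.assoc)
qed

text \<open>Going once around the base cycle shifts the fibre by \<open>\<Sum>x\<in>X. c x\<close>, a generator
  of \<open>\<int>\<^sub>m\<close>.\<close>

lemma cyclic_on_skew:
  assumes m: "m > 0" and cyc: "cyclic_on G (box m n)"
    and H: "\<And>a x. 0 \<le> a \<Longrightarrow> a < int m \<Longrightarrow> x \<in> box m n \<Longrightarrow> H (a # x) = ((a + c x) mod int m) # G x"
    and cop: "coprime (\<Sum>x\<in>box m n. c x) (int m)"
  shows "cyclic_on H (box m (Suc n))"
proof -
  let ?S = "\<Sum>x\<in>box m n. c x"
  obtain s where s: "s \<in> box m n" and orb: "box m n = orbit G s"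
    using cyc by (auto simp: cyclic_on_def)
  define N where "N = funpow_dist1 G s s"
  have self: "s \<in> orbit G s"
    using s orb by simp
  have N0: "N > 0" and per: "(G ^^ N) s = s"
    using funpow_dist1_prop[OF self] by (simp_all add: N_def)
  have img: "box m n = (\<lambda>i. (G ^^ i) s) ` {..<N}"
    using orbit_conv_funpow_dist1[OF self] orb by (simp add: N_def lessThan_atLeast0)
  have inj: "inj_on (\<lambda>i. (G ^^ i) s) {..<N}"
    using inj_on_funpow_dist1[OF self] by (simp add: N_def lessThan_atLeast0)
  have G_in: "G x \<in> box m n" if "x \<in> box m n" for x
    using cyclic_on_inI[OF cyc that] .
  have pow: "(H ^^ k) (a # x) = ((a + (\<Sum>j<k. c ((G ^^ j) x))) mod int m) # (G ^^ k) x"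
    if "0 \<le> a" "a < int m" "x \<in> box m n" for a x k
    by (rule funpow_skew[where X = "box m n"]) (use H G_in that in auto)
  have S: "(\<Sum>j<N. c ((G ^^ j) s)) = ?S"
    by (simp add: img sum.reindex[OF inj])
  have round: "(H ^^ (N * q)) (a # s) = ((a + int q * ?S) mod int m) # s"
    if "0 \<le> a" "a < int m" for a q
  proof (induction q)
    case 0
    then show ?case using that by simp
  next
    case (Suc q)
    have "(H ^^ (N * Suc q)) (a # s) = (H ^^ N) ((H ^^ (N * q)) (a # s))"
      by (simp add: funpow_add)
    also have "\<dots> = ((a + int (Suc q) * ?S) mod int m) # s"
      unfolding Suc.IH using m s
      by (subst pow) (simp_all add: S per mod_simps algebra_simps)
    finally show ?case .
  qed
  have "box m (Suc n) = orbit H (0 # s)"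
  proof (intro equalityI subsetI)
    fix y assume "y \<in> box m (Suc n)"
    then obtain b x where y: "y = b # x" "0 \<le> b" "b < int m" and "x \<in> box m n"
      by (auto simp: in_box_Suc_conv)
    then obtain i where i: "x = (G ^^ i) s"
      unfolding img by blast
    let ?e = "\<Sum>j<i. c ((G ^^ j) s)"
    \<comment> \<open>\<open>u\<close> inverts the shift of one round; the right number of rounds
      then makes up the difference \<open>b - ?e\<close> left by the last \<open>i\<close>
      steps.\<close>
    obtain u where "[?S * u = 1] (mod int m)"
      using cong_solve_coprime_int[OF cop] by blast
    then have r: "[?S * (u * (b - ?e)) = b - ?e] (mod int m)"
      using cong_scalar_right[of _ _ _ "b - ?e"] by (fastforce simp: mult.assoc)
    \<comment> \<open>Adding \<open>m\<close> keeps the residue and makes the exponent positive,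
      since \<open>orbit\<close> requires at least one application.\<close>
    define q where "q = nat (u * (b - ?e) mod int m) + m"
    have "[int q = u * (b - ?e)] (mod int m)"
      using m by (simp add: q_def cong_def)
    then have "[?S * int q = b - ?e] (mod int m)"
      using cong_trans[OF cong_scalar_left r] by blast
    then have "[int q * ?S + ?e = b] (mod int m)"
      using cong_add[OF _ cong_refl, of _ _ _ ?e] by (fastforce simp: mult.commute)
    then have val: "(int q * ?S + ?e) mod int m = b"
      using y by (simp add: cong_def)
    have "(H ^^ (i + N * q)) (0 # s) = (H ^^ i) ((int q * ?S) mod int m # s)"
      using round[of 0 q] m by (simp add: funpow_add)
    also have "\<dots> = y"
      using m s by (subst pow) (simp_all add: mod_add_left_eq val i y)
    finally show "y \<in> orbit H (0 # s)"
      using m N0 by (auto simp: orbit_altdef q_def intro!: exI[of _ "i + N * q"])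
  next
    fix y assume "y \<in> orbit H (0 # s)"
    then show "y \<in> box m (Suc n)"
      by induction (use H s m G_in in \<open>auto simp: in_box_Suc_conv\<close>)
  qed
  moreover have "0 # s \<in> box m (Suc n)"
    using s m by (simp add: Cons_in_box_iff)
  ultimately show ?thesis
    unfolding cyclic_on_def by blast
qed

text \<open>Every layer is a bijection, so along the whole cycle each layer meets every state exactly
  once; hence only the total of the increments matters.\<close>

lemma cyclic_on_tris:
  assumes m: "m > 0"
    and cop: "\<And>k. k < n \<Longrightarrow> coprime (\<Sum>t<l. \<Sum>xs\<in>box m k. f t xs) (int m)"
  shows "cyclic_on (tris m f l) (box m n)"
  using cop
proof (induction n)
  case 0
  have "orbit (tris m f l) [] = {[]}"
    by (simp add: orbit_eq_singleton_iff tris_Nil)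
  then show ?case
    by (auto simp: box_0 cyclic_on_def)
next
  case (Suc n)
  let ?c = "\<lambda>xs. \<Sum>t<l. f t (tris m f t xs)"
  have "(\<Sum>xs\<in>box m n. ?c xs) = (\<Sum>t<l. \<Sum>xs\<in>box m n. f t (tris m f t xs))"
    by (rule sum.swap)
  also have "\<dots> = (\<Sum>t<l. \<Sum>xs\<in>box m n. f t xs)"
    by (intro sum.cong refl sum.reindex_bij_betw bij_betw_tris)
  finally have "coprime (\<Sum>xs\<in>box m n. ?c xs) (int m)"
    using Suc.prems[of n] by simp
  then show ?case
    by (intro cyclic_on_skew[OF m Suc.IH]) (use Suc.prems tris_Cons in auto)
qed

text \<open>Were \<open>f\<close> independent of the head, each fibre would contribute
  \<open>m * g xs\<close>, which vanishes modulo \<open>m\<close>; only the deviations at head 0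
  survive.\<close>

lemma sum_box_Suc_cong:
  assumes m: "m > 0" and g: "\<And>a xs. a \<noteq> 0 \<Longrightarrow> xs \<in> box m n \<Longrightarrow> f (a # xs) = g xs"
    and E: "E \<subseteq> box m n" "\<And>xs. xs \<in> box m n - E \<Longrightarrow> f (0 # xs) = g xs"
  shows "[(\<Sum>xs\<in>box m (Suc n). f xs) = (\<Sum>xs\<in>E. f (0 # xs) - g xs)] (mod int m)"
proof -
  have "(\<Sum>a\<in>{0..<int m}. f (a # xs)) = int m * g xs + (f (0 # xs) - g xs)"
    if "xs \<in> box m n" for xs
  proof -
    have "(\<Sum>a\<in>{0..<int m}. f (a # xs)) = f (0 # xs) + (\<Sum>a\<in>{0..<int m} - {0}. f (a # xs))"
      using m by (intro sum.remove) auto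
    also have "(\<Sum>a\<in>{0..<int m} - {0}. f (a # xs)) = (\<Sum>a\<in>{0..<int m} - {0}. g xs)"
      by (intro sum.cong) (auto simp: g that)
    also have "\<dots> = (int m - 1) * g xs"
      using m by (simp add: of_nat_diff)
    finally show ?thesis
      by (simp add: algebra_simps)
  qed
  then have "(\<Sum>xs\<in>box m (Suc n). f xs) =
      int m * (\<Sum>xs\<in>box m n. g xs) + (\<Sum>xs\<in>box m n. f (0 # xs) - g xs)"
    by (simp add: sum_box_Suc sum.distrib sum_distrib_left)
  also have "(\<Sum>xs\<in>box m n. f (0 # xs) - g xs) = (\<Sum>xs\<in>E. f (0 # xs) - g xs)"
    by (rule sum.mono_neutral_right) (use E finite_box in auto)
  finally show ?thesis
    by (simp add: cong_def)
qed

subsection \<open>The direction tables\<close>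

text \<open>The default direction of colour \<open>\<kappa>\<close> in layer \<open>t\<close>. Each colour gets the block \<open>{0, 1, 2}\<close>
  in one or two of the first three rows and in two or three of all five, numbers coprime to \<open>m\<close>;
  this settles the first coordinate.\<close>

definition slot :: "nat \<Rightarrow> nat \<Rightarrow> nat" where
  "slot t \<kappa> =
    [[0, 1, 2, 3, 4, 5, 6],
     [4, 6, 5, 3, 1, 0, 2],
     [3, 4, 1, 0, 2, 5, 6],
     [0, 1, 3, 2, 4, 5, 6],
     [0, 3, 4, 5, 6, 1, 2]] ! t ! \<kappa>"

text \<open>The first \<open>k\<close> coordinates determine in which of the blocks a direction lies that have been
  formed by the first \<open>k\<close> of the splittings
  \<open>{0..6} = {0,1,2} \<union> {3,4,5,6}\<close>, \<open>{3,4,5,6} = {3,4} \<union> {5,6}\<close>, \<open>{3,4} = {3} \<union> {4}\<close>,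
  \<open>{5,6} = {5} \<union> {6}\<close>, \<open>{0,1,2} = {0} \<union> {1,2}\<close>, \<open>{1,2} = {1} \<union> {2}\<close>;
  \<open>part k\<close> is the left half of the splitting number \<open>k\<close>, and the coordinate number \<open>k\<close> is the sum
  over \<open>part k\<close>. The newest coordinate comes first in the lists.\<close>

definition part :: "nat \<Rightarrow> nat set" where
  "part k = [{0, 1, 2}, {3, 4}, {3}, {5}, {0}, {1}] ! k"

definition coords :: "nat \<Rightarrow> (nat \<Rightarrow> int) \<Rightarrow> int list" where
  "coords m w = map (\<lambda>k. (\<Sum>i\<in>part k. w i) mod int m) (rev [0..<6])"

text \<open>Given the coordinates \<open>xs\<close> of numbers \<open>< k\<close>, \<open>node t xs\<close> permutes directions within the
  block to be split as number \<open>k\<close>. The exceptional \<open>xs\<close> are isolated points,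
  so that they change the total increment of a colour by the number of times it is moved.\<close>

definition node :: "nat \<Rightarrow> int list \<Rightarrow> nat \<Rightarrow> nat" where
  "node t xs =
    (if t < 2 \<and> xs = [0] then transpose 3 5 \<circ> transpose 4 6
     else if t < 2 \<and> (xs = [0, 0] \<or> xs = [0, 1]) then transpose 3 4
     else if t < 2 \<and> (xs = [0, 0, 0] \<or> xs = [0, 0, 1]) then transpose 5 6
     else if t < 3 \<and> xs = [0, 0, 0, 1] then transpose 0 1
     else if t < 3 \<and> xs = [0, 0, 0, 2] then transpose 0 2
     else if t < 3 \<and> (xs = [0, 0, 0, 0, 0] \<or> xs = [0, 0, 0, 0, 1]) then transpose 1 2
     else id)"

fun dir :: "nat \<Rightarrow> nat \<Rightarrow> int list \<Rightarrow> nat" where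
  "dir t \<kappa> [] = slot t \<kappa>"
| "dir t \<kappa> (a # xs) = node t (a # xs) (dir t \<kappa> xs)"

definition incr :: "nat \<Rightarrow> nat \<Rightarrow> int list \<Rightarrow> int" where
  "incr t \<kappa> xs = of_bool (dir t \<kappa> xs \<in> part (length xs))"

text \<open>Only the first five coordinates steer the direction; the sixth, dropped by
  \<open>tl\<close>, records the outcome of the last splitting.\<close>

definition cert :: "nat \<Rightarrow> nat \<Rightarrow> (nat \<Rightarrow> int) \<Rightarrow> nat \<Rightarrow> nat" where
  "cert m t w \<kappa> = dir t \<kappa> (tl (coords m w))"

text \<open>The exceptional points of \<open>node\<close> all have head 0; these are their tails,
  sorted by length.\<close>

definition special :: "nat \<Rightarrow> int list list" where
  "special n = [[[]], [[0], [1]], [[0, 0], [0, 1]], [[0, 0, 1], [0, 0, 2]],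
     [[0, 0, 0, 0], [0, 0, 0, 1]]] ! n"

lemma bij_betw_slot:
  assumes "t < 5"
  shows "bij_betw (slot t) {..<7} {..<7}"
proof -
  have "\<forall>t\<in>set [0..<5]. slot t ` {..<7} = {..<7}"
    by code_simp
  then have "slot t ` {..<7} = {..<7}"
    using assms by simp
  then show ?thesis
    by (simp add: bij_betw_def eq_card_imp_inj_on)
qed

lemma bij_betw_transpose:
  "a \<in> A \<Longrightarrow> b \<in> A \<Longrightarrow> bij_betw (transpose a b) A A"
  by (simp add: permutes_imp_bij permutes_swap_id)

lemma bij_betw_node: "bij_betw (node t xs) {..<7} {..<7}"
proof -
  have "bij_betw (transpose 3 5 \<circ> transpose 4 6) {..<7} {..<7::nat}"
    by (rule bij_betw_trans; rule bij_betw_transpose) auto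
  then show ?thesis
    unfolding node_def by (simp add: bij_betw_transpose)
qed

lemma bij_betw_dir:
  assumes "t < 5"
  shows "bij_betw (\<lambda>\<kappa>. dir t \<kappa> xs) {..<7} {..<7}"
proof (induction xs)
  case Nil
  then show ?case
    using bij_betw_slot[OF assms] by simp
next
  case (Cons a xs)
  then show ?case
    using bij_betw_trans[OF Cons.IH bij_betw_node] by (simp add: comp_def)
qed

lemma node_nonzero: "a \<noteq> 0 \<Longrightarrow> node t (a # xs) = id"
  by (simp add: node_def)

lemma node_not_special:
  assumes "xs \<notin> set (special (length xs))"
  shows "node t (0 # xs) = id"
proof (rule ccontr)
  assume "node t (0 # xs) \<noteq> id"
  then have "xs \<in> set [[], [0], [1], [0, 0], [0, 1], [0, 0, 1], [0, 0, 2], [0, 0, 0, 0], [0, 0, 0, 1]]"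
    unfolding node_def by (simp only: split: if_splits) auto
  then show False
    using assms by (auto simp: special_def)
qed

lemma transpose_mem_iff: "a \<in> S \<longleftrightarrow> b \<in> S \<Longrightarrow> transpose a b x \<in> S \<longleftrightarrow> x \<in> S"
  by (auto simp: transpose_def)

lemma node_cases:
  assumes "P id"
    and "length xs = 1 \<Longrightarrow> P (transpose 3 5 \<circ> transpose 4 6)"
    and "length xs = 2 \<Longrightarrow> P (transpose 3 4)"
    and "length xs = 3 \<Longrightarrow> P (transpose 5 6)"
    and "length xs = 4 \<Longrightarrow> P (transpose 0 1)"
    and "length xs = 4 \<Longrightarrow> P (transpose 0 2)"
    and "length xs = 5 \<Longrightarrow> P (transpose 1 2)"
  shows "P (node t xs)"
  unfolding node_def
  by (intro if_split[where P = P, THEN iffD2] conjI impI; (elim conjE disjE)?; rule assms; simp)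

text \<open>Directions exchanged by a node share a block not yet split, so each earlier half
  contains both or neither.\<close>

lemma node_part:
  assumes "j < length xs"
  shows "node t xs x \<in> part j \<longleftrightarrow> x \<in> part j"
proof -
  have "\<forall>j\<in>set [0..<1]. (3 \<in> part j \<longleftrightarrow> 5 \<in> part j) \<and> (4 \<in> part j \<longleftrightarrow> 6 \<in> part j)"
    and "\<forall>j\<in>set [0..<2]. 3 \<in> part j \<longleftrightarrow> 4 \<in> part j"
    and "\<forall>j\<in>set [0..<3]. 5 \<in> part j \<longleftrightarrow> 6 \<in> part j"
    and "\<forall>j\<in>set [0..<4]. (0 \<in> part j \<longleftrightarrow> 1 \<in> part j) \<and> (0 \<in> part j \<longleftrightarrow> 2 \<in> part j)"
    and "\<forall>j\<in>set [0..<5]. 1 \<in> part j \<longleftrightarrow> 2 \<in> part j"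
    by code_simp+
  then have "length xs = 1 \<longrightarrow> (3 \<in> part j \<longleftrightarrow> 5 \<in> part j) \<and> (4 \<in> part j \<longleftrightarrow> 6 \<in> part j)"
    and "length xs = 2 \<longrightarrow> (3 \<in> part j \<longleftrightarrow> 4 \<in> part j)"
    and "length xs = 3 \<longrightarrow> (5 \<in> part j \<longleftrightarrow> 6 \<in> part j)"
    and "length xs = 4 \<longrightarrow> (0 \<in> part j \<longleftrightarrow> 1 \<in> part j) \<and> (0 \<in> part j \<longleftrightarrow> 2 \<in> part j)"
    and "length xs = 5 \<longrightarrow> (1 \<in> part j \<longleftrightarrow> 2 \<in> part j)"
    using assms by auto
  then show ?thesis
    by (intro node_cases[where P = "\<lambda>f. f x \<in> part j \<longleftrightarrow> x \<in> part j"])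
      (auto simp: transpose_mem_iff)
qed

text \<open>Later nodes respect the earlier halves, so the newer coordinates may be dropped. This
  makes the maps triangular.\<close>

lemma dir_part:
  assumes "j \<le> length xs"
  shows "dir t \<kappa> xs \<in> part j \<longleftrightarrow> dir t \<kappa> (drop (length xs - j) xs) \<in> part j"
  using assms
proof (induction xs)
  case (Cons a xs)
  show ?case
  proof (cases "j = length (a # xs)")
    case False
    then have "j \<le> length xs"
      using Cons.prems by simp
    then show ?thesis
      using Cons.IH by (simp add: node_part Suc_diff_le)
  qed simp
qed simp

section \<open>Total increments modulo \<open>m\<close>\<close>

lemma node_trivial_layer: "3 \<le> t \<Longrightarrow> node t xs = id"
  by (simp add: node_def)

text \<open>The sum does not involve \<open>m\<close>, so one evaluation serves both moduli; the
  listed values are coprime to every odd \<open>m\<close>.\<close>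

lemma sum_special:
  assumes "n < 5" "\<kappa> < 7"
  shows "(\<Sum>t<3. \<Sum>xs\<in>set (special n).
      incr t \<kappa> (0 # xs) - of_bool (dir t \<kappa> xs \<in> part (Suc n))) \<in> {1, -1, 2, -2}"
proof -
  have "\<forall>n\<in>set [0..<5]. \<forall>\<kappa>\<in>set [0..<7]. (\<Sum>t\<leftarrow>[0..<3]. \<Sum>xs\<leftarrow>special n.
      incr t \<kappa> (0 # xs) - of_bool (dir t \<kappa> xs \<in> part (Suc n))) \<in> set [1, -1, 2, -2]"
    by code_simp
  moreover have "\<forall>n\<in>set [0..<5]. distinct (special n)"
    by code_simp
  ultimately show ?thesis
    using assms by (simp add: sum_list_distinct_conv_sum_set atLeast0LessThan)
qed

lemma incr_coprime:
  assumes m: "m \<in> {3, 5}" and "\<kappa> < 7" and k: "k < 6"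
  shows "coprime (\<Sum>t<m. \<Sum>xs\<in>box m k. incr t \<kappa> xs) (int m)"
proof (cases k)
  case 0
  have "\<forall>m\<in>set [3, 5]. \<forall>\<kappa>\<in>set [0..<7]. (\<Sum>t\<leftarrow>[0..<m]. incr t \<kappa> []) \<in> set [1, 2, 3] \<and>
      \<not> int m dvd (\<Sum>t\<leftarrow>[0..<m]. incr t \<kappa> [])"
    by code_simp
  then have "\<not> int m dvd (\<Sum>t<m. incr t \<kappa> [])"
    using assms by (auto simp: sum_list_distinct_conv_sum_set atLeast0LessThan)
  moreover have "prime (int m)"
    using m by auto
  ultimately show ?thesis
    unfolding 0 box_0 by (simp add: prime_imp_coprime coprime_commute)
next
  case (Suc n)
  let ?e = "\<lambda>t. \<Sum>xs\<in>set (special n). incr t \<kappa> (0 # xs) - of_bool (dir t \<kappa> xs \<in> part (Suc n))"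
  have n: "n < 5"
    using k Suc by simp
  \<comment> \<open>Entries below 3 place the exceptional points in the box already for
    \<open>m = 3\<close>.\<close>
  have "\<forall>n\<in>set [0..<5]. \<forall>xs\<in>set (special n). length xs = n \<and> list_all (\<lambda>a. 0 \<le> a \<and> a < 3) xs"
    by code_simp
  then have sub: "set (special n) \<subseteq> box m n"
    using n m by (fastforce simp: box_def list_all_iff)
  have "[(\<Sum>xs\<in>box m (Suc n). incr t \<kappa> xs) = ?e t] (mod int m)" for t
    by (rule sum_box_Suc_cong[where g = "\<lambda>xs. of_bool (dir t \<kappa> xs \<in> part (Suc n))"])
      (use m n sub in \<open>auto simp: incr_def box_def node_nonzero node_not_special\<close>)
  then have "[(\<Sum>t<m. \<Sum>xs\<in>box m (Suc n). incr t \<kappa> xs) = (\<Sum>t<m. ?e t)] (mod int m)"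
    by (intro cong_sum)
  also have "(\<Sum>t<m. ?e t) = (\<Sum>t<3. ?e t)"
    by (rule sum.mono_neutral_right)
      (use m sub in \<open>auto simp: incr_def box_def node_trivial_layer intro!: sum.neutral\<close>)
  finally have cong: "[(\<Sum>t<m. \<Sum>xs\<in>box m (Suc n). incr t \<kappa> xs) = (\<Sum>t<3. ?e t)] (mod int m)" .
  have odd: "coprime 2 (int m)"
    using m by auto
  then have "coprime c (int m)" if "c \<in> {1, -1, 2, -2}" for c :: int
    using that by auto
  then have "coprime (\<Sum>t<3. ?e t) (int m)"
    using sum_special[OF n assms(2)] by blast
  then show ?thesis
    unfolding Suc using cong_imp_coprime[OF cong_sym[OF cong]] by blast
qed

subsection \<open>Coordinates on the root flat\<close>

text \<open>Solves the block sums for the entries of \<open>w\<close>; the last entry comes from the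
  zero-sum condition.\<close>

definition lift :: "int list \<Rightarrow> int list" where
  "lift zs = [zs ! 1, zs ! 0, zs ! 5 - zs ! 1 - zs ! 0, zs ! 3, zs ! 4 - zs ! 3, zs ! 2,
    - zs ! 5 - zs ! 4 - zs ! 2]"

definition uncoords :: "nat \<Rightarrow> int list \<Rightarrow> nat \<Rightarrow> int" where
  "uncoords m zs = (\<lambda>i\<in>{..<7}. lift zs ! i mod int m)"

lemma sum_less_7: "(\<Sum>i<7. w i) = w 0 + w 1 + w 2 + w 3 + w 4 + w 5 + w 6"
  for w :: "nat \<Rightarrow> int"
  by (simp add: eval_nat_numeral)

lemma coords_eq: "coords m w = [w 1 mod int m, w 0 mod int m, w 5 mod int m, w 3 mod int m,
    (w 3 + w 4) mod int m, (w 0 + w 1 + w 2) mod int m]"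
  by (simp add: coords_def part_def upt_rec add.assoc)

lemma coords_in_box: "m > 0 \<Longrightarrow> coords m w \<in> box m 6"
  by (simp add: coords_eq box_def)

lemma less_7_cases: "(i::nat) < 7 \<Longrightarrow> i = 0 \<or> i = 1 \<or> i = 2 \<or> i = 3 \<or> i = 4 \<or> i = 5 \<or> i = 6"
  by auto

lemma uncoords_in_A7:
  assumes "m > 0"
  shows "uncoords m zs \<in> A7 m"
proof -
  have "(\<Sum>i<7. uncoords m zs i) mod int m = (\<Sum>i<7. lift zs ! i) mod int m"
    by (simp add: uncoords_def mod_sum_eq)
  also have "\<dots> = 0"
    unfolding sum_less_7 by (simp add: lift_def)
  finally show ?thesis
    using assms by (auto simp: A7_def Zvec_def uncoords_def)
qed

lemma uncoords_coords:
  assumes "w \<in> A7 m"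
  shows "uncoords m (coords m w) = w"
proof
  fix i
  have w: "w \<in> {..<7} \<rightarrow>\<^sub>E {0..<int m}"
    and sum: "int m dvd w 0 + w 1 + w 2 + w 3 + w 4 + w 5 + w 6"
    using assms unfolding A7_def Zvec_def sum_less_7 by auto
  have "(- (w 0 + w 1 + w 2) - (w 3 + w 4) - w 5) - w 6 =
      - (w 0 + w 1 + w 2 + w 3 + w 4 + w 5 + w 6)"
    by simp
  then have w6: "(- (w 0 + w 1 + w 2) - (w 3 + w 4) - w 5) mod int m = w 6 mod int m"
    by (simp only: mod_eq_dvd_iff dvd_minus_iff sum)
  show "uncoords m (coords m w) i = w i"
  proof (cases "i < 7")
    case True
    have "lift (coords m w) ! i mod int m = w i mod int m"
      using less_7_cases[OF True]
    proof (elim disjE)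
      assume i: "i = 2"
      have "[(w 0 + w 1 + w 2) mod int m - w 0 mod int m - w 1 mod int m =
          (w 0 + w 1 + w 2) - w 0 - w 1] (mod int m)"
        by (intro cong_diff) (simp_all only: cong_def mod_mod_trivial)
      then show ?thesis
        unfolding i by (simp add: lift_def coords_eq cong_def)
    next
      assume i: "i = 6"
      have "[- ((w 0 + w 1 + w 2) mod int m) - (w 3 + w 4) mod int m - w 5 mod int m =
          - (w 0 + w 1 + w 2) - (w 3 + w 4) - w 5] (mod int m)"
        by (intro cong_diff) (simp_all only: cong_def mod_minus_eq mod_mod_trivial)
      then show ?thesis
        unfolding i w6[symmetric] by (simp add: lift_def coords_eq cong_def)
    qed (simp_all add: lift_def coords_eq mod_simps)
    also have "\<dots> = w i"
      using w True by (auto simp: PiE_iff)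
    finally show ?thesis
      using True by (simp add: uncoords_def)
  next
    case False
    then show ?thesis
      using w by (simp add: uncoords_def PiE_iff extensional_def)
  qed
qed

lemma coords_uncoords:
  assumes "zs \<in> box m 6"
  shows "coords m (uncoords m zs) = zs"
proof -
  obtain a b c d e f where "zs = [a, b, c, d, e, f]"
    using assms by (auto simp: box_def length_Suc_conv numeral_eq_Suc)
  then show ?thesis
    using assms by (simp add: coords_eq uncoords_def lift_def box_def mod_simps)
qed

lemma bij_betw_uncoords:
  assumes "m > 0"
  shows "bij_betw (uncoords m) (box m 6) (A7 m)"
  by (rule bij_betw_byWitness[where f' = "coords m"])
    (use assms in \<open>auto simp: uncoords_coords coords_uncoords coords_in_box uncoords_in_A7\<close>)

text \<open>The case \<open>i = 6\<close> fits the same formula, because the two indicators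
  cancel.\<close>

lemma vadd_qvec:
  assumes "i < 7" "j < 7"
  shows "vadd m w (qvec m i) j = (w j + (of_bool (j = i) - of_bool (j = 6))) mod int m"
  using assms
  by (cases "i = 6"; cases "j = i"; cases "j = 6")
    (simp_all add: vadd_def qvec_def vdiff_def unit_vec_def vzero_def mod_add_right_eq)

lemma sum_vadd_qvec:
  assumes "i < 7" "S \<subseteq> {..<7}"
  shows "(\<Sum>j\<in>S. vadd m w (qvec m i) j) mod int m =
    ((\<Sum>j\<in>S. w j) + (of_bool (i \<in> S) - of_bool (6 \<in> S))) mod int m"
proof -
  have fin: "finite S"
    using assms(2) finite_subset by blast
  have "(\<Sum>j\<in>S. vadd m w (qvec m i) j) =
      (\<Sum>j\<in>S. (w j + (of_bool (j = i) - of_bool (j = 6))) mod int m)"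
    using assms by (intro sum.cong refl vadd_qvec) auto
  then have "(\<Sum>j\<in>S. vadd m w (qvec m i) j) mod int m =
      (\<Sum>j\<in>S. w j + (of_bool (j = i) - of_bool (j = 6))) mod int m"
    by (simp only: mod_sum_eq)
  also have "(\<Sum>j\<in>S. w j + (of_bool (j = i) - of_bool (j = 6))) =
      (\<Sum>j\<in>S. w j) + (of_bool (i \<in> S) - of_bool (6 \<in> S))"
    using fin by (simp add: sum.distrib sum_subtractf of_bool_def)
  finally show ?thesis .
qed

lemma vadd_qvec_in_A7:
  assumes "m > 0" "w \<in> A7 m" "i < 7"
  shows "vadd m w (qvec m i) \<in> A7 m"
proof -
  have "vadd m w (qvec m i) \<in> Zvec m"
    using assms(1) by (auto simp: Zvec_def vadd_def)
  then show ?thesis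
    using assms sum_vadd_qvec[of i "{..<7}" m w] by (simp add: A7_def)
qed

text \<open>No \<open>part k\<close> contains \<open>6\<close>, so adding \<open>e\<^sub>i - e\<^sub>6\<close> raises the coordinate number \<open>k\<close> iff
  \<open>i \<in> part k\<close>.\<close>

lemma coord_step:
  assumes "i < 7" "k < 6"
  shows "(\<Sum>j\<in>part k. vadd m w (qvec m i) j) mod int m =
    ((\<Sum>j\<in>part k. w j) mod int m + of_bool (i \<in> part k)) mod int m"
proof -
  have "\<forall>k\<in>set [0..<6]. 6 \<notin> part k \<and> part k \<subseteq> set [0..<7]"
    by code_simp
  then have "6 \<notin> part k" "part k \<subseteq> {..<7}"
    using assms(2) by (auto simp: atLeast0LessThan)
  then show ?thesis
    using sum_vadd_qvec[OF assms(1), of "part k" m w] by (simp add: mod_add_left_eq)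
qed

section \<open>Conjugation of the certificate maps to triangular maps\<close>

lemma dir_less: "t < 5 \<Longrightarrow> \<kappa> < 7 \<Longrightarrow> dir t \<kappa> xs < 7"
  using bij_betw_dir[of t xs] by (auto simp: bij_betw_def)

lemma map_rev_upt_tri:
  assumes "\<And>k. k < n \<Longrightarrow> c' k = (c k + f (map c (rev [0..<k]))) mod int m"
  shows "map c' (rev [0..<n]) = tri m f (map c (rev [0..<n]))"
  using assms by (induction n) auto

lemma coords_Pmap:
  assumes "t < 5" "\<kappa> < 7"
  shows "coords m (Pmap m (cert m) t \<kappa> w) = tri m (incr t \<kappa>) (coords m w)"
  unfolding coords_def
proof (rule map_rev_upt_tri)
  fix k :: nat assume k: "k < 6"
  let ?c = "\<lambda>k. (\<Sum>i\<in>part k. w i) mod int m"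
  let ?xs = "tl (coords m w)"
  have xs: "?xs = map ?c (rev [0..<5])"
    by (simp add: coords_def upt_rec)
  have "drop (5 - k) ?xs = map ?c (rev [0..<k])"
    using k unfolding xs by (simp add: drop_map drop_rev)
  \<comment> \<open>The direction is chosen from all five coordinates, but its membership in
    \<open>part k\<close> needs only those numbered below \<open>k\<close>.\<close>
  then have "dir t \<kappa> ?xs \<in> part k \<longleftrightarrow> dir t \<kappa> (map ?c (rev [0..<k])) \<in> part k"
    using dir_part[of k ?xs t \<kappa>] k by (simp add: xs)
  then show "(\<Sum>i\<in>part k. Pmap m (cert m) t \<kappa> w i) mod int m =
      (?c k + incr t \<kappa> (map ?c (rev [0..<k]))) mod int m"
    using coord_step[OF dir_less[OF assms] k] by (simp add: Pmap_def cert_def incr_def)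
qed

lemma Pmap_in_A7: "m > 0 \<Longrightarrow> t < 5 \<Longrightarrow> \<kappa> < 7 \<Longrightarrow> w \<in> A7 m \<Longrightarrow> Pmap m (cert m) t \<kappa> w \<in> A7 m"
  unfolding Pmap_def cert_def by (intro vadd_qvec_in_A7 dir_less)

lemma Pmap_uncoords:
  assumes "m > 0" "t < 5" "\<kappa> < 7" "zs \<in> box m 6"
  shows "Pmap m (cert m) t \<kappa> (uncoords m zs) = uncoords m (tri m (incr t \<kappa>) zs)"
proof -
  have "coords m (Pmap m (cert m) t \<kappa> (uncoords m zs)) = tri m (incr t \<kappa>) zs"
    using assms by (simp add: coords_Pmap coords_uncoords)
  then show ?thesis
    using uncoords_coords Pmap_in_A7 uncoords_in_A7 assms by metis
qed

text \<open>Composed with the bijection \<open>uncoords\<close>, the map becomes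
  \<open>uncoords\<close> after the bijection \<open>tri\<close>.\<close>

lemma bij_betw_Pmap:
  assumes "m > 0" "t < 5" "\<kappa> < 7"
  shows "bij_betw (Pmap m (cert m) t \<kappa>) (A7 m) (A7 m)"
proof -
  have "bij_betw (Pmap m (cert m) t \<kappa> \<circ> uncoords m) (box m 6) (A7 m)"
    using bij_betw_trans[OF bij_betw_tri bij_betw_uncoords[OF assms(1)]]
    by (rule iffD1[OF bij_betw_cong, rotated]) (simp add: Pmap_uncoords assms)
  then show ?thesis
    using bij_betw_comp_iff bij_betw_uncoords assms(1) by blast
qed

lemma Pcomp_uncoords:
  assumes "m > 0" "m \<le> 5" "\<kappa> < 7" "zs \<in> box m 6"
  shows "Pcomp m (cert m) \<kappa> (uncoords m zs) = uncoords m (tris m (\<lambda>t. incr t \<kappa>) m zs)"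
proof -
  have "fold (\<lambda>t. Pmap m (cert m) t \<kappa>) [0..<n] (uncoords m zs) =
      uncoords m (tris m (\<lambda>t. incr t \<kappa>) n zs)" if "n \<le> m" for n
    using that
  proof (induction n)
    case (Suc n)
    have "tris m (\<lambda>t. incr t \<kappa>) n zs \<in> box m 6"
      using bij_betw_tris assms(4) by (rule bij_betw_apply)
    then show ?case
      using Suc assms by (simp add: Pmap_uncoords)
  qed simp
  then show ?thesis
    by (simp add: Pcomp_def)
qed

lemma valid_cert:
  assumes m: "m \<in> {3, 5}"
  shows "valid_root_flat_certificate m (cert m)"
proof -
  have m': "m > 0" "m \<le> 5"
    using m by auto
  have A7: "A7 m = uncoords m ` box m 6"
    using bij_betw_uncoords[OF m'(1)] by (simp add: bij_betw_def)
  have "cyclic_on (Pcomp m (cert m) \<kappa>) (A7 m)" if "\<kappa> < 7" for \<kappa>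
    unfolding A7 using cyclic_on_tris[OF m'(1) incr_coprime[OF m that]]
    by (rule cyclic_on_image) (use m' that Pcomp_uncoords in auto)
  moreover have "card (A7 m) = m ^ 6"
    using bij_betw_same_card[OF bij_betw_uncoords[OF m'(1)]] by (simp add: card_box)
  moreover have "bij_betw (cert m t w) {..<7} {..<7}" if "t < m" for t w
    using bij_betw_dir[of t "tl (coords m w)"] that m' by (simp add: cert_def[abs_def])
  ultimately show ?thesis
    unfolding valid_root_flat_certificate_def using m' bij_betw_Pmap by simp
qed

theorem theorem4p2:
  fixes m :: nat
  assumes "m \<in> {3, 5}"
  shows "\<exists>d. valid_root_flat_certificate m d"
  using valid_cert[OF assms] by blast

end
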